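(* Let $d \ge 0$ be an integer and let $f(x)=\sum_{i=0}^d b_i x^i$ be a polynomial of degree $d$ with positive real coefficients, i.e. $b_i>0$ for all $0\le i\le d$. Then there exists a positive real number $k$ such that the polynomial $f(kx)$ (in the variable $x$) is magic positive.
   Context: A polynomial $g(x)\in\mathbb{R}[x]$ of degree $d$ is called magic positive if, in its unique expansion $g(x)=\sum_{i=0}^d a_i\,x^i(x+1)^{d-i}$ with respect to the basis $\{x^i(x+1)^{d-i}\}_{i=0}^d$ of the real polynomials of degree at most $d$, all coefficients satisfy $a_i\ge 0$. *)

theory Defs
  imports Complex_Main "HOL-Computational_Algebra.Polynomial"
begin

definition magic_basis :: "nat \<Rightarrow> nat \<Rightarrow> real poly" where
  "magic_basis d i = [:0, 1:] ^ i * [:1, 1:] ^ (d - i)"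

(* The expansion with respect to the basis exists and is unique (lemma magic_expansion_ex1),
   so it does not matter that the coefficients are introduced by an existential quantifier. *)
definition magic_positive :: "real poly \<Rightarrow> bool" where
  "magic_positive g \<longleftrightarrow>
     (\<exists>a :: nat \<Rightarrow> real.
        g = (\<Sum>i\<le>degree g. smult (a i) (magic_basis (degree g) i)) \<and>
        (\<forall>i\<le>degree g. a i \<ge> 0))"

lemma magic_expansion_Suc:
  "(\<Sum>i\<le>Suc d. smult (a i) (magic_basis (Suc d) i)) =
     smult (a 0) ([:1, 1:] ^ Suc d) +
     [:0, 1:] * (\<Sum>i\<le>d. smult (a (Suc i)) (magic_basis d i))"
  by (simp only: sum.atMost_Suc_shift sum_distrib_left)
     (simp add: magic_basis_def mult.assoc)

lemma magic_expansion_exists: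
  assumes "degree p \<le> d"
  shows "\<exists>a. p = (\<Sum>i\<le>d. smult (a i) (magic_basis d i))"
  using assms
proof (induction d arbitrary: p)
  case 0
  then have "p = [:coeff p 0:]"
    by (metis degree_0_id le_zero_eq)
  then show ?case
    by (intro exI[of _ "\<lambda>_. coeff p 0"]) (simp add: magic_basis_def)
next
  case (Suc d)
  define r where "r = p - smult (poly p 0) ([:1, 1:] ^ Suc d)"
  have "poly r 0 = 0"
    by (simp add: r_def)
  then obtain q where q: "r = [:0, 1:] * q"
    by (metis dvdE minus_zero poly_eq_0_iff_dvd)
  have "degree r \<le> Suc d"
    unfolding r_def
    by (intro degree_diff_le Suc.prems order.trans[OF degree_smult_le])
       (simp only: degree_linear_power order.refl)
  then have "degree q \<le> d"
    unfolding q by (cases "q = 0") (simp_all add: degree_mult_eq)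
  then obtain a where a: "q = (\<Sum>i\<le>d. smult (a i) (magic_basis d i))"
    using Suc.IH by blast
  have "p = smult (poly p 0) ([:1, 1:] ^ Suc d) + [:0, 1:] * q"
    using q by (simp add: r_def algebra_simps)
  then show ?case
    by (intro exI[of _ "case_nat (poly p 0) a"])
       (simp only: magic_expansion_Suc nat.case a)
qed

lemma magic_expansion_unique:
  assumes "(\<Sum>i\<le>d. smult (a i) (magic_basis d i)) =
             (\<Sum>i\<le>d. smult (b i) (magic_basis d i))"
    and "i \<le> d"
  shows "a i = b i"
  using assms
proof (induction d arbitrary: a b i)
  case 0
  then show ?case
    by (simp add: magic_basis_def)
next
  case (Suc d)
  note eq = Suc.prems(1)[unfolded magic_expansion_Suc]
  have zero: "a 0 = b 0"
    using arg_cong[OF eq, of "\<lambda>p. poly p 0"] by simp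
  have "[:0, 1:] * (\<Sum>i\<le>d. smult (a (Suc i)) (magic_basis d i)) =
        [:0, 1:] * (\<Sum>i\<le>d. smult (b (Suc i)) (magic_basis d i))"
    using eq unfolding zero by (simp only: add_left_cancel)
  then have "(\<Sum>i\<le>d. smult (a (Suc i)) (magic_basis d i)) =
             (\<Sum>i\<le>d. smult (b (Suc i)) (magic_basis d i))"
    by simp
  then have "a (Suc j) = b (Suc j)" if "j \<le> d" for j
    using Suc.IH[of "\<lambda>i. a (Suc i)" "\<lambda>i. b (Suc i)"] that by blast
  then show ?case
    using zero Suc.prems(2) by (cases i) auto
qed

lemma magic_expansion_ex1:
  assumes "degree p \<le> d"
  shows "\<exists>!a. (\<forall>i>d. a i = 0) \<and> p = (\<Sum>i\<le>d. smult (a i) (magic_basis d i))"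
proof -
  obtain a where a: "p = (\<Sum>i\<le>d. smult (a i) (magic_basis d i))"
    using magic_expansion_exists[OF assms] by blast
  show ?thesis
  proof (rule ex1I[of _ "\<lambda>i. if i \<le> d then a i else 0"])
    show "(\<forall>i>d. (if i \<le> d then a i else 0) = 0) \<and>
        p = (\<Sum>i\<le>d. smult (if i \<le> d then a i else 0) (magic_basis d i))"
      using a by simp
  next
    fix b
    assume b: "(\<forall>i>d. b i = 0) \<and> p = (\<Sum>i\<le>d. smult (b i) (magic_basis d i))"
    then have "b i = a i" if "i \<le> d" for i
      using magic_expansion_unique[of b d a i] a that by simp
    then show "b = (\<lambda>i. if i \<le> d then a i else 0)"
      using b by (auto simp: fun_eq_iff)
  qed
qed

end

theory Submission
  imports Defs
begin

text \<open>
  Expanding \<open>x^i = x^i * ((x + 1) - x)^(d - i)\<close> binomially shows that the coefficient of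
  \<open>x^m * (x + 1)^(d - m)\<close> in \<open>f (k * x)\<close> is
  \<open>(\<Sum>i\<le>m. (- 1)^(m - i) * (d - i choose (m - i)) * b i * k^i)\<close>.
  This is a polynomial in \<open>k\<close> with leading coefficient \<open>b m > 0\<close>, hence positive for large \<open>k\<close>.
\<close>

lemma X_power_magic_expansion:
  assumes "i \<le> d"
  shows "[:0, 1:] ^ i =
    (\<Sum>m\<in>{i..d}. smult ((- 1) ^ (m - i) * of_nat (d - i choose (m - i))) (magic_basis d m))"
proof -
  let ?X = "[:0, 1:] :: real poly" and ?Y = "[:1, 1:] :: real poly"
  have neg: "(- ?X) ^ j = smult ((- 1) ^ j) (?X ^ j)" for j
    using smult_power[of "- 1" ?X j] by simp
  have "1 = (- ?X + ?Y) ^ (d - i)"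
    by (simp add: pCons_one)
  also have "\<dots> = (\<Sum>j\<le>d - i.
      smult ((- 1) ^ j * of_nat (d - i choose j)) (?X ^ j * ?Y ^ (d - i - j)))"
    unfolding binomial_ring neg by (simp add: of_nat_poly mult.commute)
  finally have "?X ^ i = ?X ^ i * (\<Sum>j\<le>d - i.
      smult ((- 1) ^ j * of_nat (d - i choose j)) (?X ^ j * ?Y ^ (d - i - j)))"
    by simp
  \<comment> \<open>The exponents fit because d - i - j = d - (i + j), so each product is again a
    basis element.\<close>
  also have "\<dots> = (\<Sum>j\<le>d - i.
      smult ((- 1) ^ j * of_nat (d - i choose j)) (magic_basis d (i + j)))"
    by (simp add: sum_distrib_left magic_basis_def power_add mult.assoc)
  also have "\<dots> = (\<Sum>m\<in>{i..d}.
      smult ((- 1) ^ (m - i) * of_nat (d - i choose (m - i))) (magic_basis d m))"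
    by (rule sum.reindex_bij_witness[of _ "\<lambda>m. m - i" "\<lambda>j. i + j"]) (use assms in auto)
  finally show ?thesis .
qed

lemma pcompose_scale_conv_sum:
  fixes f :: "'a::comm_ring_1 poly"
  shows "pcompose f [:0, k:] = (\<Sum>i\<le>degree f. smult (coeff f i * k ^ i) ([:0, 1:] ^ i))"
proof (rule poly_eqI)
  fix n
  have "coeff (\<Sum>i\<le>degree f. monom (coeff f i * k ^ i) i) n = k ^ n * coeff f n"
    by (simp add: coeff_sum coeff_eq_0 mult.commute)
  then show "coeff (pcompose f [:0, k:]) n =
      coeff (\<Sum>i\<le>degree f. smult (coeff f i * k ^ i) ([:0, 1:] ^ i)) n"
    by (simp add: coeff_pcompose_linear monom_altdef)
qed

lemma smult_sum_right: "smult c (\<Sum>i\<in>S. p i) = (\<Sum>i\<in>S. smult c (p i))"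
  by (induction S rule: infinite_finite_induct) (simp_all add: smult_add_right)

text \<open>The indeterminate here is the scaling factor k, not x: as a polynomial in k, the
  coefficient can be controlled for large k through its leading term.\<close>

definition magic_coeff_poly :: "real poly \<Rightarrow> nat \<Rightarrow> real poly" where
  "magic_coeff_poly f m =
     (\<Sum>i\<le>m. monom (coeff f i * ((- 1) ^ (m - i) * of_nat (degree f - i choose (m - i)))) i)"

lemma pcompose_scale_magic_expansion:
  "pcompose f [:0, k:] =
     (\<Sum>m\<le>degree f. smult (poly (magic_coeff_poly f m) k) (magic_basis (degree f) m))"
proof -
  let ?d = "degree f"
  let ?c = "\<lambda>i m. coeff f i * ((- 1) ^ (m - i) * of_nat (?d - i choose (m - i))) * k ^ i"
  have "pcompose f [:0, k:] = (\<Sum>i\<le>?d. \<Sum>m\<in>{i..?d}. smult (?c i m) (magic_basis ?d m))"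
    unfolding pcompose_scale_conv_sum
    by (intro sum.cong)
       (simp_all add: X_power_magic_expansion[of _ ?d] smult_sum_right mult_ac)
  \<comment> \<open>Writing the triangle i \<le> m \<le> d as a relation on a square lets the order
    of summation be exchanged; afterwards i \<le> d follows from i \<le> m.\<close>
  also have "\<dots> = (\<Sum>i\<le>?d. \<Sum>m | m \<le> ?d \<and> i \<le> m. smult (?c i m) (magic_basis ?d m))"
    by (intro sum.cong) auto
  also have "\<dots> = (\<Sum>m\<le>?d. \<Sum>i | i \<le> ?d \<and> i \<le> m. smult (?c i m) (magic_basis ?d m))"
    using sum.swap_restrict[of "{..?d}" "{..?d}" "\<lambda>i m. smult (?c i m) (magic_basis ?d m)" "(\<le>)"]
    by simp
  also have "\<dots> = (\<Sum>m\<le>?d. \<Sum>i\<le>m. smult (?c i m) (magic_basis ?d m))"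
    by (intro sum.cong) auto
  also have "\<dots> = (\<Sum>m\<le>?d. smult (poly (magic_coeff_poly f m) k) (magic_basis ?d m))"
    by (simp add: magic_coeff_poly_def poly_sum poly_monom smult_sum)
  finally show ?thesis .
qed

lemma eventually_magic_coeff_poly_pos:
  assumes "coeff f m > 0"
  shows "eventually (\<lambda>k. poly (magic_coeff_poly f m) k > 0) at_top"
proof -
  \<comment> \<open>Only the summand i = m contributes, and its sign and binomial coefficient are
    both 1.\<close>
  have c: "coeff (magic_coeff_poly f m) m = coeff f m"
    by (simp add: magic_coeff_poly_def coeff_sum)
  have "degree (magic_coeff_poly f m) \<le> m"
    unfolding magic_coeff_poly_def
    by (intro degree_sum_le) (auto intro: order.trans[OF degree_monom_le])
  moreover have "m \<le> degree (magic_coeff_poly f m)"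
    using assms c by (intro le_degree) simp
  ultimately have "lead_coeff (magic_coeff_poly f m) > 0"
    using assms c by simp
  \<comment> \<open>A real polynomial with positive leading coefficient eventually stays above that
    coefficient, hence above 0.\<close>
  moreover from this obtain n where
    "\<And>k. k \<ge> n \<Longrightarrow> poly (magic_coeff_poly f m) k \<ge> lead_coeff (magic_coeff_poly f m)"
    using poly_pinfty_gt_lc by blast
  ultimately show ?thesis
    unfolding eventually_at_top_linorder by (metis order.strict_trans2)
qed

theorem theorem1p3:
  fixes d :: nat and f :: "real poly"
  assumes "degree f = d"
    and "\<And>i. i \<le> d \<Longrightarrow> coeff f i > 0"
  shows "\<exists>k::real. k > 0 \<and> magic_positive (pcompose f [:0, k:])"
proof -
  \<comment> \<open>There are only finitely many m, so a single threshold for k serves all of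
    them.\<close>
  have "eventually (\<lambda>k. \<forall>m\<in>{..d}. poly (magic_coeff_poly f m) k > 0) at_top"
    using assms(2) by (intro eventually_ball_finite ballI eventually_magic_coeff_poly_pos) auto
  then have "eventually (\<lambda>k. k > 0 \<and> (\<forall>m\<in>{..d}. poly (magic_coeff_poly f m) k > 0)) at_top"
    by (intro eventually_conj eventually_gt_at_top)
  then obtain k where k: "k > 0" "\<And>m. m \<le> d \<Longrightarrow> poly (magic_coeff_poly f m) k > 0"
    using eventually_happens'[OF trivial_limit_at_top_linorder] by (metis (lifting) atMost_iff)
  \<comment> \<open>\<open>magic_positive\<close> expands relative to the degree of its own
    argument; scaling by a nonzero k keeps that degree at d.\<close>
  have "degree (pcompose f [:0, k:]) = d"
    using k(1) assms(1) by (simp add: degree_pcompose)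
  then have "magic_positive (pcompose f [:0, k:])"
    unfolding magic_positive_def
    using pcompose_scale_magic_expansion[of f k] k(2) assms(1)
    by (intro exI[of _ "\<lambda>m. poly (magic_coeff_poly f m) k"]) (auto intro: less_imp_le)
  with k(1) show ?thesis
    by blast
qed

end
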